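(* Every metric space with straight finite decomposition complexity (sFDC) has Property A.
   Context: For nonempty subsets $A,B$ of a metric space put $d(A,B)=\inf\{d(a,b)\mid a\in A,\ b\in B\}$. For $R>0$, a family $\mathcal A$ of nonempty subsets of a metric space is $R$-disjoint if $d(A,B)>R$ for all distinct $A,B\in\mathcal A$. A metric family is a family (set) of metric spaces; subsets of a metric space are regarded as metric spaces with the restricted metric. Let $\mathcal X,\mathcal Y$ be metric families and $R>0$. $\mathcal X$ is $R$-decomposable over $\mathcal Y$ if for every $X\in\mathcal X$ there are $R$-disjoint families $\mathcal V_1,\mathcal V_2$ of subsets of $X$ with $X=\bigcup(\mathcal V_1\cup\mathcal V_2)$ and $\mathcal V_1\cup\mathcal V_2\subset\mathcal Y$. A metric family $\mathcal X$ is bounded if $\sup\{\mathrm{diam}\,X\mid X\in\mathcal X\}<\infty$. sFDC: A metric space $X$ has sFDC if for every sequence $R_1<R_2<\cdots$ of positive numbers there exist $n\in\mathbb N$ and metric families $\mathcal V_1,\dots,\mathcal V_n$ such that $\{X\}$ is $R_1$-decomposable over $\mathcal V_1$, $\mathcal V_i$ is $R_{i+1}$-decomposable over $\mathcal V_{i+1}$ for $i=1,\dots,n-1$, and $\mathcal V_n$ is bounded. Property A: A metric space $X$ is discrete if there is $C>0$ such that $d(x,y)\ge C$ for all $x\ne y$ in $X$. A discrete metric space $X$ has Property A if for every $\varepsilon>0$ and $R>0$ there exist a collection of nonempty finite subsets $\{A_x\}_{x\in X}$, $A_x\subset X\times\mathbb N$, and a constant $S>0$ such that (1) $A_x\cap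 A_y\neq\emptyset$ and $\frac{\#(A_x\Delta A_y)}{\#(A_x\cap A_y)}\le\varepsilon$ whenever $d(x,y)<R$; (2) $A_x\subset B(x,S)\times\mathbb N$ for all $x\in X$, where $B(x,S)$ is the ball of radius $S$ about $x$. An arbitrary metric space has Property A if it contains a coarsely dense discrete subset with Property A (a subset $D\subset X$ is coarsely dense if there is $r>0$ such that every point of $X$ is within distance $r$ of some point of $D$). *)

theory Defs
  imports "HOL-Analysis.Analysis"
begin

definition set_distance :: "'a metric \<Rightarrow> 'a set \<Rightarrow> 'a set \<Rightarrow> real" where
  "set_distance X A B = Inf {mdist X a b | a b. a \<in> A \<and> b \<in> B}"

definition disjoint_family_at :: "'a metric \<Rightarrow> real \<Rightarrow> 'a set set \<Rightarrow> bool" where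
  "disjoint_family_at X R \<A> \<longleftrightarrow>
     (\<forall>A\<in>\<A>. A \<noteq> {} \<and> A \<subseteq> mspace X) \<and>
     (\<forall>A\<in>\<A>. \<forall>B\<in>\<A>. A \<noteq> B \<longrightarrow> set_distance X A B > R)"

text \<open>A metric family is a set of metric spaces; its members may have arbitrary, unrelated metrics
  on carriers inside one type. A subset \<^term>\<open>V\<close> of \<^term>\<open>X\<close>, with the restricted metric, is
  the metric space \<^term>\<open>submetric X V\<close>.\<close>

definition decomposable_over :: "real \<Rightarrow> 'a metric set \<Rightarrow> 'a metric set \<Rightarrow> bool" where
  "decomposable_over R \<X> \<Y> \<longleftrightarrow>
     (\<forall>X\<in>\<X>. \<exists>\<V>\<^sub>1 \<V>\<^sub>2. disjoint_family_at X R \<V>\<^sub>1 \<and> disjoint_family_at X R \<V>\<^sub>2 \<and>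
        mspace X = \<Union>(\<V>\<^sub>1 \<union> \<V>\<^sub>2) \<and> submetric X ` (\<V>\<^sub>1 \<union> \<V>\<^sub>2) \<subseteq> \<Y>)"

definition metric_diam :: "'a metric \<Rightarrow> ereal" where
  "metric_diam X = (SUP (x, y) \<in> mspace X \<times> mspace X. ereal (mdist X x y))"

definition bounded_metric_family :: "'a metric set \<Rightarrow> bool" where
  "bounded_metric_family \<X> \<longleftrightarrow> (SUP X\<in>\<X>. metric_diam X) < \<infinity>"

text \<open>Sequences and families are indexed from 1; the values at index 0 are irrelevant.\<close>

definition sFDC :: "'a metric \<Rightarrow> bool" where
  "sFDC X \<longleftrightarrow>
     (\<forall>R :: nat \<Rightarrow> real. (\<forall>i\<ge>1. 0 < R i) \<and> (\<forall>i\<ge>1. R i < R (i + 1)) \<longrightarrow>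
        (\<exists>n\<ge>1. \<exists>\<V> :: nat \<Rightarrow> 'a metric set.
           decomposable_over (R 1) {X} (\<V> 1) \<and>
           (\<forall>i\<in>{1..<n}. decomposable_over (R (i + 1)) (\<V> i) (\<V> (i + 1))) \<and>
           bounded_metric_family (\<V> n)))"

definition discrete_metric_space :: "'a metric \<Rightarrow> bool" where
  "discrete_metric_space X \<longleftrightarrow>
     (\<exists>C>0. \<forall>x\<in>mspace X. \<forall>y\<in>mspace X. x \<noteq> y \<longrightarrow> mdist X x y \<ge> C)"

definition discrete_property_A :: "'a metric \<Rightarrow> bool" where
  "discrete_property_A X \<longleftrightarrow> discrete_metric_space X \<and>
     (\<forall>\<epsilon>>0. \<forall>R>0. \<exists>(A :: 'a \<Rightarrow> ('a \<times> nat) set) S. S > 0 \<and>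
        (\<forall>x\<in>mspace X. A x \<noteq> {} \<and> finite (A x) \<and> A x \<subseteq> mspace X \<times> UNIV) \<and>
        (\<forall>x\<in>mspace X. \<forall>y\<in>mspace X. mdist X x y < R \<longrightarrow>
           A x \<inter> A y \<noteq> {} \<and>
           real (card (sym_diff (A x) (A y))) / real (card (A x \<inter> A y)) \<le> \<epsilon>) \<and>
        (\<forall>x\<in>mspace X. A x \<subseteq> mball_of X x S \<times> UNIV))"

definition coarsely_dense :: "'a metric \<Rightarrow> 'a set \<Rightarrow> bool" where
  "coarsely_dense X D \<longleftrightarrow> D \<subseteq> mspace X \<and>
     (\<exists>r>0. \<forall>x\<in>mspace X. \<exists>y\<in>D. mdist X x y \<le> r)"

definition property_A :: "'a metric \<Rightarrow> bool" where
  "property_A X \<longleftrightarrow> (\<exists>D. coarsely_dense X D \<and> discrete_property_A (submetric X D))"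

end

theory Submission
  imports Defs
begin

text \<open>The idea is to retract \<open>X\<close> onto bounded pieces at random. If \<open>X\<close> is the union of two
  sufficiently disjoint families \<open>\<V>\<^sub>1\<close>, \<open>\<V>\<^sub>2\<close>, choose a radius \<open>t\<close> uniformly among \<open>r, 2r, \<dots>, Kr\<close>
  and move a point to the \<open>\<V>\<^sub>1\<close>-piece at distance less than \<open>t\<close>, or, if there is none, leave it in its
  \<open>\<V>\<^sub>2\<close>-piece. Two points at distance less than \<open>r\<close> land in the same piece, at distance less than
  \<open>(2K + 1) r\<close>, except for at most one of the \<open>K\<close> radii. Iterating with errors \<open>\<epsilon>/2, \<epsilon>/4, \<dots>\<close>,
  which fixes the scales \<open>R\<^sub>i\<close> in advance, and collapsing the bounded pieces to points at the end,
  nearby points are mapped to the same point with probability at least \<open>1 - \<epsilon>\<close>. With \<open>z\<^sub>j\<close>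
  running through the \<open>N\<close> outcomes, \<open>A\<^sub>x = {(z\<^sub>j x, j) | j < N}\<close> witnesses Property A.\<close>

section \<open>Random retractions with finitely many equally likely outcomes\<close>

definition random_retraction ::
    "'a metric \<Rightarrow> nat \<Rightarrow> real \<Rightarrow> real \<Rightarrow> real \<Rightarrow> (nat \<Rightarrow> 'a \<Rightarrow> 'a) \<Rightarrow> bool" where
  "random_retraction Y N S r \<delta> z \<longleftrightarrow>
     (\<forall>j. \<forall>x\<in>mspace Y. z j x \<in> mspace Y \<and> mdist Y x (z j x) \<le> S) \<and>
     (\<forall>x\<in>mspace Y. \<forall>y\<in>mspace Y. mdist Y x y < r \<longrightarrow>
        real (card {j. j < N \<and> z j x \<noteq> z j y}) \<le> \<delta> * real N)"

text \<open>\<open>N\<close> and \<open>S\<close> are fixed before \<open>Y\<close>: retractions of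
  different pieces can then be glued along a common outcome index, with a common bound on the
  displacement.\<close>

definition randomly_retractable :: "'a metric set \<Rightarrow> real \<Rightarrow> real \<Rightarrow> bool" where
  "randomly_retractable \<F> r \<delta> \<longleftrightarrow>
     (\<exists>N>0. \<exists>S. \<forall>Y\<in>\<F>. \<exists>z. random_retraction Y N S r \<delta> z)"

lemma random_retraction_in: "random_retraction Y N S r \<delta> z \<Longrightarrow> x \<in> mspace Y \<Longrightarrow> z j x \<in> mspace Y"
  and random_retraction_mdist_le:
    "random_retraction Y N S r \<delta> z \<Longrightarrow> x \<in> mspace Y \<Longrightarrow> mdist Y x (z j x) \<le> S"
  and random_retraction_card_le:
    "random_retraction Y N S r \<delta> z \<Longrightarrow> x \<in> mspace Y \<Longrightarrow> y \<in> mspace Y \<Longrightarrow> mdist Y x y < r \<Longrightarrow>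
      real (card {j. j < N \<and> z j x \<noteq> z j y}) \<le> \<delta> * real N"
  unfolding random_retraction_def by simp_all

section \<open>Distances in disjoint and in bounded families\<close>

lemma mdist_self: "x \<in> mspace X \<Longrightarrow> mdist X x x = 0"
  using mdist_zero[of x X x] by simp

lemma mdist_gt_of_disjoint_family_at:
  assumes "disjoint_family_at X R \<A>" "A \<in> \<A>" "B \<in> \<A>" "A \<noteq> B" "a \<in> A" "b \<in> B"
  shows "mdist X a b > R"
proof -
  have "set_distance X A B \<le> mdist X a b"
    unfolding set_distance_def
    by (rule cInf_lower) (use assms in \<open>auto intro!: bdd_belowI[of _ 0]\<close>)
  moreover have "set_distance X A B > R"
    using assms by (auto simp: disjoint_family_at_def)
  ultimately show ?thesis by linarith
qed

lemma bounded_metric_familyE: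
  assumes "bounded_metric_family \<F>"
  obtains S where "\<And>Y x y. Y \<in> \<F> \<Longrightarrow> x \<in> mspace Y \<Longrightarrow> y \<in> mspace Y \<Longrightarrow> mdist Y x y \<le> S"
proof -
  \<comment> \<open>Only an upper bound, since the supremum is minus infinity for an empty family or
    a family of empty spaces.\<close>
  obtain S where S: "(SUP Y\<in>\<F>. metric_diam Y) \<le> ereal S"
    using assms unfolding bounded_metric_family_def
    by (cases "SUP Y\<in>\<F>. metric_diam Y") auto
  show ?thesis
  proof
    fix Y x y assume Y: "Y \<in> \<F>" and "x \<in> mspace Y" "y \<in> mspace Y"
    then have "ereal (mdist Y x y) \<le> metric_diam Y"
      unfolding metric_diam_def by (intro SUP_upper2[of "(x, y)"]) auto
    also have "\<dots> \<le> (SUP Y\<in>\<F>. metric_diam Y)" using Y by (rule SUP_upper)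
    finally show "mdist Y x y \<le> S" using S by (metis ereal_less_eq(3) order_trans)
  qed
qed

text \<open>Each space is collapsed to one chosen point. The single outcome identifies all pairs, so
  every scale \<open>r\<close> works, and the common diameter bound limits the displacement.\<close>

lemma randomly_retractable_bounded:
  assumes "bounded_metric_family \<F>" "\<delta> \<ge> 0"
  shows "randomly_retractable \<F> r \<delta>"
proof -
  obtain S where S: "\<And>Y x y. Y \<in> \<F> \<Longrightarrow> x \<in> mspace Y \<Longrightarrow> y \<in> mspace Y \<Longrightarrow> mdist Y x y \<le> S"
    using bounded_metric_familyE[OF assms(1)] by blast
  show ?thesis
    unfolding randomly_retractable_def
  proof (intro exI[of _ "1::nat"] conjI exI[of _ S] ballI)
    fix Y assume Y: "Y \<in> \<F>"
    show "\<exists>z. random_retraction Y 1 S r \<delta> z"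
      unfolding random_retraction_def
      by (rule exI[of _ "\<lambda>j x. SOME x. x \<in> mspace Y"])
         (use S[OF Y] assms(2) in \<open>auto intro: someI intro!: S[OF Y]\<close>)
  qed simp
qed

section \<open>One decomposition step: a random radius\<close>

lemma card_threshold_le_1:
  fixes P Q :: "nat \<Rightarrow> bool"
  assumes "\<And>k. P k \<Longrightarrow> Q (Suc k)" "\<And>k. Q k \<Longrightarrow> P (Suc k)"
    and "mono P" "mono Q"
  shows "card {k. k < K \<and> P k \<noteq> Q k} \<le> 1"
proof -
  \<comment> \<open>If exactly one of the predicates holds at \<open>k\<close>, then both hold at
    \<open>Suc k\<close>, and by monotonicity from there on. So no second disagreement can
    follow.\<close>
  have "P l = Q l" if "P k \<noteq> Q k" "k < l" for k l
  proof -
    have "Suc k \<le> l" using that by simp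
    then have "P k \<Longrightarrow> P l" "Q k \<Longrightarrow> Q l" "P (Suc k) \<Longrightarrow> P l" "Q (Suc k) \<Longrightarrow> Q l"
      using monoD[OF assms(3)] monoD[OF assms(4)] that(2) by (meson le_boolD less_imp_le)+
    then show ?thesis using assms(1,2)[of k] that(1) by blast
  qed
  then have "a = b" if "P a \<noteq> Q a" "P b \<noteq> Q b" for a b
    using that by (metis linorder_neqE_nat)
  then show ?thesis by (simp add: card_le_Suc0_iff_eq)
qed

text \<open>An outcome is a pair: one of \<open>K\<close> radii, then one of \<open>N\<close>
  outcomes inside the piece reached. The summand \<open>1 / real K\<close> pays for the one radius
  at which two nearby points may be treated differently, \<delta> for the retraction of the piece.
  The first move is shorter than \<open>K * r\<close>, so points less than \<open>r\<close> apart
  stay less than \<open>(2 * K + 1) * r\<close> apart; hence this number serves both as disjointness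
  of the pieces and as scale for \<open>\<G>\<close>.\<close>

lemma randomly_retractable_decomposable:
  assumes dec: "decomposable_over ((2 * real K + 1) * r) \<F> \<G>"
    and \<G>: "randomly_retractable \<G> ((2 * real K + 1) * r) \<delta>"
    and K: "K > 0" and r: "r > 0"
  shows "randomly_retractable \<F> r (1 / real K + \<delta>)"
proof -
  let ?R = "(2 * real K + 1) * r"
  obtain N S where N: "N > 0" and NS: "\<forall>Y\<in>\<G>. \<exists>z. random_retraction Y N S ?R \<delta> z"
    using \<G> unfolding randomly_retractable_def by blast
  have "\<exists>w. random_retraction Y (K * N) (real K * r + S) r (1 / real K + \<delta>) w"
    if Y: "Y \<in> \<F>" for Y
  proof -
    obtain \<V>1 \<V>2 where V1: "disjoint_family_at Y ?R \<V>1" and V2: "disjoint_family_at Y ?R \<V>2"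
      and cover: "mspace Y = \<Union>(\<V>1 \<union> \<V>2)" and sub: "submetric Y ` (\<V>1 \<union> \<V>2) \<subseteq> \<G>"
      using bspec[OF dec[unfolded decomposable_over_def] Y] by (elim exE conjE) (rule that)
    have V_sub: "mspace (submetric Y V) = V" if "V \<in> \<V>1 \<union> \<V>2" for V
      using that cover by auto
    have "\<exists>z. random_retraction (submetric Y V) N S ?R \<delta> z" if "V \<in> \<V>1 \<union> \<V>2" for V
      using that NS sub by blast
    then obtain Z where
      retr: "\<And>V. V \<in> \<V>1 \<union> \<V>2 \<Longrightarrow> random_retraction (submetric Y V) N S ?R \<delta> (Z V)"
      by metis
    have Z: "Z V j x \<in> V \<and> mdist Y x (Z V j x) \<le> S" if "V \<in> \<V>1 \<union> \<V>2" "x \<in> V" for V j x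
      using random_retraction_in[OF retr[OF that(1)], of x j]
        random_retraction_mdist_le[OF retr[OF that(1)], of x j] that(2)
      by (simp only: V_sub[OF that(1)] mdist_submetric)
    have Z\<delta>: "real (card {j. j < N \<and> Z V j x \<noteq> Z V j y}) \<le> \<delta> * real N"
      if "V \<in> \<V>1 \<union> \<V>2" "x \<in> V" "y \<in> V" "mdist Y x y < ?R" for V x y
      using random_retraction_card_le[OF retr[OF that(1)], of x y] that(2-4)
      by (simp only: V_sub[OF that(1)] mdist_submetric)
    \<comment> \<open>Index \<open>k < K\<close> stands for the radius \<open>Suc k * r\<close>. All
      radii are positive, so a point of a \<open>\<V>1\<close>-piece satisfies \<open>H\<close> at
      every \<open>k\<close>; where \<open>H\<close> fails, the point lies in a
      \<open>\<V>2\<close>-piece.\<close>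
    define H where "H x k \<longleftrightarrow> (\<exists>V\<in>\<V>1. \<exists>v\<in>V. mdist Y x v < real (Suc k) * r)" for x k
    define T where "T k x V p \<longleftrightarrow> V \<in> \<V>1 \<union> \<V>2 \<and> p \<in> V \<and>
        (H x k \<longrightarrow> V \<in> \<V>1 \<and> mdist Y x p < real (Suc k) * r) \<and> (\<not> H x k \<longrightarrow> V \<in> \<V>2 \<and> p = x)"
      for k x V p
    have "\<exists>V p. T k x V p" if x: "x \<in> mspace Y" for x k
    proof (cases "H x k")
      case True
      then show ?thesis unfolding T_def H_def by blast
    next
      case False
      have "x \<notin> \<Union>\<V>1"
      proof
        assume "x \<in> \<Union>\<V>1"
        moreover have "mdist Y x x < real (Suc k) * r" using x r by (simp add: mdist_self)
        ultimately show False using False unfolding H_def by blast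
      qed
      then show ?thesis using x cover False unfolding T_def by blast
    qed
    then have "\<forall>k. \<forall>x\<in>mspace Y. \<exists>V p. T k x V p" by blast
    then obtain V p where T: "\<forall>k. \<forall>x\<in>mspace Y. T k x (V k x) (p k x)"
      unfolding bchoice_iff choice_iff by blast
    then have Vp: "\<And>x k. x \<in> mspace Y \<Longrightarrow> V k x \<in> \<V>1 \<union> \<V>2 \<and> p k x \<in> V k x"
      and VpH: "\<And>x k. x \<in> mspace Y \<Longrightarrow> H x k \<Longrightarrow> V k x \<in> \<V>1 \<and> mdist Y x (p k x) < real (Suc k) * r"
      and Vpn: "\<And>x k. x \<in> mspace Y \<Longrightarrow> \<not> H x k \<Longrightarrow> V k x \<in> \<V>2 \<and> p k x = x"
      unfolding T_def by blast+
    have p: "p k x \<in> mspace Y" if "x \<in> mspace Y" for k x using Vp[OF that] cover by blast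
    have pd: "mdist Y x (p k x) < real K * r" if "x \<in> mspace Y" "k < K" for k x
    proof (cases "H x k")
      case True
      have "real (Suc k) * r \<le> real K * r" using that r by (intro mult_right_mono) auto
      then show ?thesis using VpH[OF that(1) True] by linarith
    next
      case False
      then show ?thesis using Vpn[OF that(1) False] that r K by (simp add: mdist_self)
    qed
    have pp: "mdist Y (p k x) (p k y) < ?R"
      if "x \<in> mspace Y" "y \<in> mspace Y" "mdist Y x y < r" "k < K" for k x y
    proof -
      have "mdist Y (p k x) (p k y) \<le> mdist Y x (p k x) + mdist Y x y + mdist Y y (p k y)"
        using mdist_triangle[of "p k x" Y x "p k y"] mdist_triangle[of x Y y "p k y"] p that
        by (simp add: mdist_commute)
      then show ?thesis using pd[of x k] pd[of y k] that by (simp add: algebra_simps)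
    qed
    \<comment> \<open>Agreement of \<open>H\<close> puts both pieces into the same family; two
      distinct ones would force the points \<open>p k x\<close> and \<open>p k y\<close> more than
      \<open>?R\<close> apart.\<close>
    have same: "V k x = V k y"
      if xy: "x \<in> mspace Y" "y \<in> mspace Y" "mdist Y x y < r" "k < K" and HH: "H x k = H y k" for k x y
    proof (rule ccontr)
      assume ne: "V k x \<noteq> V k y"
      have "V k x \<in> \<V>1 \<and> V k y \<in> \<V>1 \<or> V k x \<in> \<V>2 \<and> V k y \<in> \<V>2"
        using HH VpH Vpn xy by metis
      then have "mdist Y (p k x) (p k y) > ?R"
        using mdist_gt_of_disjoint_family_at[OF V1 _ _ ne] mdist_gt_of_disjoint_family_at[OF V2 _ _ ne]
          Vp xy by metis
      then show False using pp[OF xy] by simp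
    qed
    \<comment> \<open>The pair of radius index and inner outcome is coded as
      \<open>j = k * N + i\<close>. The \<open>mod K\<close> keeps the radius index below
      \<open>K\<close> for every \<open>j\<close>, because the displacement bound is demanded beyond
      \<open>K * N\<close> as well.\<close>
    define w where "w j x = (let k = (j div N) mod K in Z (V k x) (j mod N) (p k x))" for j x
    show ?thesis
      unfolding random_retraction_def
    proof (intro exI[of _ w] conjI allI ballI impI)
      fix j x assume x: "x \<in> mspace Y"
      define k where "k = (j div N) mod K"
      have k: "k < K" using K by (simp add: k_def)
      have *: "w j x \<in> V k x" "mdist Y (p k x) (w j x) \<le> S"
        using Z Vp[OF x] unfolding w_def k_def Let_def by blast+
      then show w: "w j x \<in> mspace Y" using Vp[OF x, of k] cover by blast
      show "mdist Y x (w j x) \<le> real K * r + S"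
        using mdist_triangle[OF x p[OF x] w, of k] *(2) pd[OF x k] by linarith
    next
      fix x y assume xy: "x \<in> mspace Y" "y \<in> mspace Y" "mdist Y x y < r"
      \<comment> \<open>\<open>B\<close> holds the bad radii, \<open>D k\<close> the bad inner
        outcomes at radius \<open>k\<close>. Using \<open>V k x\<close> for both points in
        \<open>D\<close> is harmless: for \<open>k < K\<close> outside \<open>B\<close> the pieces
        coincide.\<close>
      define B where "B = {k. k < K \<and> H x k \<noteq> H y k}"
      define D where "D k = {j. j < N \<and> Z (V k x) j (p k x) \<noteq> Z (V k x) j (p k y)}" for k
      \<comment> \<open>A point of \<open>\<V>1\<close> close to \<open>a\<close> is less than
        \<open>r\<close> farther from \<open>b\<close>, which the next radius absorbs. This supplies
        the interleaving for \<open>card_threshold_le_1\<close>.\<close>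
      have H_Suc: "H b (Suc k)" if ab: "a \<in> mspace Y" "b \<in> mspace Y" "mdist Y a b < r" "H a k" for a b k
      proof -
        obtain U v where Uv: "U \<in> \<V>1" "v \<in> U" "mdist Y a v < real (Suc k) * r"
          using ab(4) unfolding H_def by blast
        moreover have "v \<in> mspace Y" using Uv cover by blast
        ultimately have "mdist Y b v < real (Suc (Suc k)) * r"
          using mdist_triangle[of b Y a v] ab by (simp add: mdist_commute algebra_simps)
        then show ?thesis using Uv unfolding H_def by blast
      qed
      have H_mono: "mono (H a)" for a
      proof (intro monoI le_boolI)
        fix k l :: nat assume "k \<le> l" "H a k"
        moreover have "real (Suc k) * r \<le> real (Suc l) * r"
          using \<open>k \<le> l\<close> r by (intro mult_right_mono) auto
        ultimately show "H a l" unfolding H_def by (meson order_less_le_trans)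
      qed
      have B: "card B \<le> 1"
        unfolding B_def using H_Suc[of x y] H_Suc[of y x] xy H_mono
        by (intro card_threshold_le_1) (auto simp: mdist_commute)
      have finB: "finite B" unfolding B_def by simp
      have D: "real (card (D k)) \<le> \<delta> * real N" if "k \<in> {..<K} - B" for k
        unfolding D_def
        using that xy Vp[OF xy(1), of k] Vp[OF xy(2), of k] same[OF xy, of k] pp[OF xy, of k]
        by (intro Z\<delta>) (auto simp: B_def)
      have finD: "finite (D k)" for k unfolding D_def by simp
      \<comment> \<open>The sign comes from the estimate for the pair \<open>x\<close>,
        \<open>x\<close> in a piece containing \<open>x\<close>. It allows the sum over good radii
        to be extended to all \<open>K\<close> radii.\<close>
      have \<delta>: "\<delta> * real N \<ge> 0"
      proof -
        have "x \<in> \<Union>(\<V>1 \<union> \<V>2)" using xy cover by simp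
        then obtain U where "U \<in> \<V>1 \<union> \<V>2" "x \<in> U" by blast
        moreover have "?R > 0" using r K by simp
        ultimately show ?thesis using Z\<delta>[of U x x] xy by (simp add: mdist_self)
      qed
      \<comment> \<open>Failures: a bad radius with any inner outcome, or a good radius with a bad
        inner outcome.\<close>
      let ?E = "B \<times> {..<N} \<union> Sigma ({..<K} - B) D"
      have "{j. j < K * N \<and> w j x \<noteq> w j y} \<subseteq> (\<lambda>(k, j). k * N + j) ` ?E"
      proof
        fix j assume "j \<in> {j. j < K * N \<and> w j x \<noteq> w j y}"
        then have j: "j < K * N" "w j x \<noteq> w j y" by auto
        then have k: "j div N < K" using N by (simp add: less_mult_imp_div_less)
        have "(j div N, j mod N) \<in> ?E"
        proof (cases "j div N \<in> B")
          case True
          then show ?thesis using N by simp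
        next
          case False
          then have "V (j div N) y = V (j div N) x" using same[OF xy k] k by (auto simp: B_def)
          then show ?thesis using False k j(2) N by (simp add: D_def w_def Let_def)
        qed
        then show "j \<in> (\<lambda>(k, j). k * N + j) ` ?E" by (rule rev_image_eqI) simp
      qed
      then have "card {j. j < K * N \<and> w j x \<noteq> w j y} \<le> card ?E"
        by (rule surj_card_le[rotated]) (use finB finD in auto)
      also have "\<dots> \<le> card (B \<times> {..<N}) + card (Sigma ({..<K} - B) D)" by (rule card_Un_le)
      also have "\<dots> = card B * N + (\<Sum>k\<in>{..<K} - B. card (D k))"
        by (simp add: finD card_cartesian_product)
      finally have "real (card {j. j < K * N \<and> w j x \<noteq> w j y})
          \<le> real (card B * N + (\<Sum>k\<in>{..<K} - B. card (D k)))"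
        by (rule of_nat_mono)
      also have "\<dots> = real (card B) * real N + (\<Sum>k\<in>{..<K} - B. real (card (D k)))"
        by simp
      finally have "real (card {j. j < K * N \<and> w j x \<noteq> w j y})
          \<le> real (card B) * real N + (\<Sum>k\<in>{..<K} - B. real (card (D k)))" .
      moreover have "real (card B) * real N \<le> real N"
        using B mult_right_mono[of "real (card B)" 1 "real N"] by simp
      moreover have "(\<Sum>k\<in>{..<K} - B. real (card (D k))) \<le> (\<Sum>k\<in>{..<K} - B. \<delta> * real N)"
        using D by (rule sum_mono)
      moreover have "(\<Sum>k\<in>{..<K} - B. \<delta> * real N) \<le> (\<Sum>k<K. \<delta> * real N)"
        by (rule sum_mono2) (use \<delta> in simp_all)
      moreover have "real N + (\<Sum>k<K. \<delta> * real N) = (1 / real K + \<delta>) * real (K * N)"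
        using K by (simp add: field_simps)
      ultimately show "real (card {j. j < K * N \<and> w j x \<noteq> w j y})
          \<le> (1 / real K + \<delta>) * real (K * N)"
        by linarith
    qed
  qed
  moreover have "K * N > 0" using K N by simp
  ultimately show ?thesis
    unfolding randomly_retractable_def by (intro exI[of _ "K * N"] exI[of _ "real K * r + S"] conjI ballI)
qed

section \<open>Iteration along the decompositions given by sFDC\<close>

lemma randomly_retractable_mono:
  fixes \<F> :: "'a metric set"
  assumes "randomly_retractable \<F> r \<delta>" "\<delta> \<le> \<delta>'"
  shows "randomly_retractable \<F> r \<delta>'"
proof -
  have "random_retraction Y N S r \<delta>' z" if "random_retraction Y N S r \<delta> z"
    for Y :: "'a metric" and N S z
  proof -
    have "\<delta> * real N \<le> \<delta>' * real N" using assms(2) by (simp add: mult_right_mono)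
    then show ?thesis using that unfolding random_retraction_def by force
  qed
  then show ?thesis using assms(1) unfolding randomly_retractable_def by metis
qed

lemma sFDC_randomly_retractable:
  assumes "sFDC X" "r > 0" "\<epsilon> > 0"
  shows "randomly_retractable {X} r \<epsilon>"
proof -
  \<comment> \<open>The length \<open>n\<close> is known only after the whole sequence of scales is
    given, so the errors must be summable over all levels: step \<open>i\<close> may spend
    \<open>\<epsilon> / 2 ^ i\<close>.\<close>
  define K where "K i = Suc (nat \<lceil>2 ^ i / \<epsilon>\<rceil>)" for i :: nat
  have K: "1 / real (K i) \<le> \<epsilon> / 2 ^ i" for i
  proof -
    have "2 ^ i / \<epsilon> \<le> real (K i)" unfolding K_def by linarith
    moreover have "real (K i) > 0" by (simp add: K_def)
    ultimately show ?thesis using assms(3) by (simp add: field_simps)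
  qed
  \<comment> \<open>Consecutive scales have exactly the ratio that
    \<open>randomly_retractable_decomposable\<close> asks for. \<open>R 0 = r\<close> is the target
    scale; sFDC sees the sequence from index 1.\<close>
  define R where "R = rec_nat r (\<lambda>i s. (2 * real (K (Suc i)) + 1) * s)"
  have R_0: "R 0 = r" and R_Suc: "R (Suc i) = (2 * real (K (Suc i)) + 1) * R i" for i
    by (simp_all add: R_def)
  have R_pos: "R i > 0" for i
    by (induction i) (auto simp: R_0 R_Suc assms(2) intro!: mult_pos_pos add_nonneg_pos)
  have "R i < R (Suc i)" for i
  proof -
    have "1 * R i < (2 * real (K (Suc i)) + 1) * R i"
      using R_pos by (intro mult_strict_right_mono) (auto simp: K_def)
    then show ?thesis by (simp add: R_Suc)
  qed
  with R_pos have "\<exists>n\<ge>1. \<exists>\<V> :: nat \<Rightarrow> 'a metric set. decomposable_over (R 1) {X} (\<V> 1) \<and>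
           (\<forall>i\<in>{1..<n}. decomposable_over (R (i + 1)) (\<V> i) (\<V> (i + 1))) \<and>
           bounded_metric_family (\<V> n)"
    using assms(1) unfolding sFDC_def by simp
  then obtain n \<V> where n: "n \<ge> 1" and dec1: "decomposable_over (R 1) {X} (\<V> 1)"
    and dec: "\<And>i. i \<in> {1..<n} \<Longrightarrow> decomposable_over (R (i + 1)) (\<V> i) (\<V> (i + 1))"
    and bdd: "bounded_metric_family (\<V> n)"
    by blast
  \<comment> \<open>Half of the error allowed at level \<open>i\<close> goes to the random radius,
    the other half is the error inherited from level \<open>Suc i\<close>.\<close>
  have descend: "randomly_retractable \<F> (R i) (\<epsilon> / 2 ^ i)"
    if "decomposable_over (R (Suc i)) \<F> \<G>" "randomly_retractable \<G> (R (Suc i)) (\<epsilon> / 2 ^ Suc i)"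
    for i \<F> and \<G> :: "'a metric set"
  proof (rule randomly_retractable_mono)
    show "randomly_retractable \<F> (R i) (1 / real (K (Suc i)) + \<epsilon> / 2 ^ Suc i)"
      using that R_pos by (intro randomly_retractable_decomposable[where \<G> = \<G>])
        (auto simp: R_Suc K_def)
    show "1 / real (K (Suc i)) + \<epsilon> / 2 ^ Suc i \<le> \<epsilon> / 2 ^ i"
      using K[of "Suc i"] by simp
  qed
  \<comment> \<open>Downward induction from the bounded family \<open>\<V> n\<close>, where any
    nonnegative error can be achieved.\<close>
  have \<V>: "randomly_retractable (\<V> i) (R i) (\<epsilon> / 2 ^ i)" if "1 \<le> i" "i \<le> n" for i
    using that(2,1)
  proof (induction i rule: inc_induct)
    case base
    then show ?case using bdd assms(3) by (intro randomly_retractable_bounded) auto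
  next
    case (step i)
    show ?case
      by (rule descend[of i "\<V> i" "\<V> (Suc i)"]) (use dec[of i] step in simp_all)
  qed
  have "randomly_retractable {X} (R 0) (\<epsilon> / 2 ^ 0)"
    by (rule descend[of 0 "{X}" "\<V> 1"]) (use dec1 \<V>[of 1] n in simp_all)
  then show ?thesis by (simp add: R_0)
qed

section \<open>Passage to a discrete net, and Property A\<close>

lemma maximal_separated_subset:
  fixes X :: "'a metric"
  obtains D where "D \<subseteq> mspace X" "\<And>x y. x \<in> D \<Longrightarrow> y \<in> D \<Longrightarrow> x \<noteq> y \<Longrightarrow> mdist X x y \<ge> 1"
    "\<And>x. x \<in> mspace X \<Longrightarrow> \<exists>y\<in>D. mdist X x y \<le> 1"
proof -
  define \<S> where "\<S> = {D. D \<subseteq> mspace X \<and> (\<forall>x\<in>D. \<forall>y\<in>D. x \<noteq> y \<longrightarrow> mdist X x y \<ge> 1)}"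
  have "\<Union>\<C> \<in> \<S>" if "subset.chain \<S> \<C>" for \<C>
  proof -
    have "mdist X x y \<ge> 1" if "A \<in> \<C>" "B \<in> \<C>" "x \<in> A" "y \<in> B" "x \<noteq> y" for A B x y
    proof -
      have "A \<subseteq> B \<or> B \<subseteq> A" "A \<in> \<S>" "B \<in> \<S>"
        using \<open>subset.chain \<S> \<C>\<close> that unfolding subset_chain_def by blast+
      then show ?thesis using that unfolding \<S>_def by blast
    qed
    then show ?thesis using that unfolding \<S>_def subset_chain_def by blast
  qed
  then obtain D where D: "D \<in> \<S>" and max: "\<And>E. E \<in> \<S> \<Longrightarrow> D \<subseteq> E \<Longrightarrow> E = D"
    using subset_Zorn'[of \<S>] by blast
  show ?thesis
  proof
    show "D \<subseteq> mspace X" "\<And>x y. x \<in> D \<Longrightarrow> y \<in> D \<Longrightarrow> x \<noteq> y \<Longrightarrow> mdist X x y \<ge> 1"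
      using D unfolding \<S>_def by blast+
    show "\<exists>y\<in>D. mdist X x y \<le> 1" if x: "x \<in> mspace X" for x
    proof (rule ccontr)
      assume *: "\<not> (\<exists>y\<in>D. mdist X x y \<le> 1)"
      then have "insert x D \<in> \<S>"
        using D x unfolding \<S>_def by (force simp: mdist_commute)
      then have "x \<in> D" using max[of "insert x D"] by blast
      moreover have "mdist X x x \<le> 1" using x by (simp add: mdist_self)
      ultimately show False using * by blast
    qed
  qed
qed

text \<open>Outcomes are pushed into the net by a nearest-point style map \<open>q\<close>. The tag
  \<open>j\<close> makes \<open>A x\<close> the graph of a function on the \<open>N\<close>
  outcomes, so intersections and symmetric differences count agreements and disagreements.\<close>

lemma separated_net_discrete_property_A:
  assumes retr: "\<And>r \<epsilon>. r > 0 \<Longrightarrow> \<epsilon> > 0 \<Longrightarrow> randomly_retractable {X} r \<epsilon>"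
    and DX: "D \<subseteq> mspace X"
    and sep: "\<And>x y. x \<in> D \<Longrightarrow> y \<in> D \<Longrightarrow> x \<noteq> y \<Longrightarrow> mdist X x y \<ge> 1"
    and net: "\<And>x. x \<in> mspace X \<Longrightarrow> \<exists>y\<in>D. mdist X x y \<le> 1"
  shows "discrete_property_A (submetric X D)"
proof -
  have sp [simp]: "mspace (submetric X D) = D" using DX by auto
  obtain q where qD: "\<And>x. x \<in> mspace X \<Longrightarrow> q x \<in> D" and qd: "\<And>x. x \<in> mspace X \<Longrightarrow> mdist X x (q x) \<le> 1"
    using net by metis
  have "\<exists>(A :: 'a \<Rightarrow> ('a \<times> nat) set) S. S > 0 \<and>
        (\<forall>x\<in>D. A x \<noteq> {} \<and> finite (A x) \<and> A x \<subseteq> D \<times> UNIV) \<and>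
        (\<forall>x\<in>D. \<forall>y\<in>D. mdist X x y < R \<longrightarrow>
           A x \<inter> A y \<noteq> {} \<and>
           real (card (sym_diff (A x) (A y))) / real (card (A x \<inter> A y)) \<le> \<epsilon>) \<and>
        (\<forall>x\<in>D. A x \<subseteq> mball_of (submetric X D) x S \<times> UNIV)"
    if \<epsilon>: "\<epsilon> > 0" and R: "R > 0" for \<epsilon> R :: real
  proof -
    \<comment> \<open>The solution of \<open>2 * \<delta> / (1 - \<delta>) = \<epsilon>\<close>: at
      most \<open>2 * \<delta> * N\<close> elements differ and at least
      \<open>(1 - \<delta>) * N\<close> are shared.\<close>
    define \<delta> where "\<delta> = \<epsilon> / (2 + \<epsilon>)"
    have \<delta>: "\<delta> > 0" "\<delta> < 1" "2 * \<delta> = \<epsilon> * (1 - \<delta>)" using \<epsilon> by (auto simp: \<delta>_def field_simps)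
    obtain N S z where N: "N > 0" and retr: "random_retraction X N S R \<delta> z"
      using retr[OF R \<delta>(1)] unfolding randomly_retractable_def by blast
    have z: "z j x \<in> mspace X \<and> mdist X x (z j x) \<le> S" if "x \<in> mspace X" for j x
      using random_retraction_in[OF retr that] random_retraction_mdist_le[OF retr that] by simp
    note zz = random_retraction_card_le[OF retr]
    define A where "A x = (\<lambda>j. (q (z j x), j)) ` {..<N}" for x
    have A_iff: "p \<in> A x \<longleftrightarrow> snd p < N \<and> fst p = q (z (snd p) x)" for p x
      by (cases p) (auto simp: A_def)
    show ?thesis
    \<comment> \<open>The map \<open>q\<close> adds at most 1 to the displacement \<open>S\<close>;
      the rest makes the bound strict for the open ball, and the absolute value keeps the radius
      positive.\<close>
    proof (intro exI[of _ A] exI[of _ "\<bar>S\<bar> + 2"] conjI ballI impI)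
      fix x assume x: "x \<in> D"
      then have xX: "x \<in> mspace X" using DX by blast
      show "A x \<noteq> {}" "finite (A x)" using N by (auto simp: A_def)
      show "A x \<subseteq> D \<times> UNIV" using z[OF xX] qD by (auto simp: A_def)
      have "q (z j x) \<in> mball_of (submetric X D) x (\<bar>S\<bar> + 2)" for j
      proof -
        have "mdist X x (q (z j x)) < \<bar>S\<bar> + 2"
          using mdist_triangle[of x X "z j x" "q (z j x)"] z[OF xX, of j] qd[of "z j x"]
            qD[of "z j x"] xX DX by force
        then show ?thesis using x qD[of "z j x"] z[OF xX] DX by auto
      qed
      then show "A x \<subseteq> mball_of (submetric X D) x (\<bar>S\<bar> + 2) \<times> UNIV" by (auto simp: A_def)
    next
      fix x y assume x: "x \<in> D" and y: "y \<in> D" and d: "mdist X x y < R"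
      define B where "B = {j. j < N \<and> q (z j x) \<noteq> q (z j y)}"
      \<comment> \<open>Applying \<open>q\<close> can only merge values, so it creates no new
        disagreement.\<close>
      have "card B \<le> card {j. j < N \<and> z j x \<noteq> z j y}" by (rule card_mono) (auto simp: B_def)
      also have "real \<dots> \<le> \<delta> * real N" using zz x y d DX by blast
      finally have B: "real (card B) \<le> \<delta> * real N" by simp
      have BN: "B \<subseteq> {..<N}" "finite B" by (auto simp: B_def)
      have "A x \<inter> A y = (\<lambda>j. (q (z j x), j)) ` ({..<N} - B)"
        by (auto simp: A_iff B_def image_iff)
      then have "card (A x \<inter> A y) = card ({..<N} - B)" by (simp add: card_image inj_on_def)
      also have "\<dots> = N - card B" using BN by (simp add: card_Diff_subset)
      finally have cI: "real (card (A x \<inter> A y)) = real N - real (card B)"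
        using card_mono[OF _ BN(1)] by simp
      have "sym_diff (A x) (A y) \<subseteq> (\<lambda>j. (q (z j x), j)) ` B \<union> (\<lambda>j. (q (z j y), j)) ` B"
        by (auto simp: A_iff B_def image_iff)
      then have "card (sym_diff (A x) (A y))
          \<le> card ((\<lambda>j. (q (z j x), j)) ` B \<union> (\<lambda>j. (q (z j y), j)) ` B)"
        using BN by (intro card_mono) auto
      also have "\<dots> \<le> card B + card B"
        using BN by (intro order_trans[OF card_Un_le] add_mono card_image_le)
      finally have cD: "real (card (sym_diff (A x) (A y))) \<le> 2 * (\<delta> * real N)" using B by linarith
      have I: "real (card (A x \<inter> A y)) \<ge> (1 - \<delta>) * real N" using cI B by (simp add: algebra_simps)
      have pos: "(1 - \<delta>) * real N > 0" using \<delta> N by simp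
      show "A x \<inter> A y \<noteq> {}" using I pos by force
      have "2 * (\<delta> * real N) = \<epsilon> * ((1 - \<delta>) * real N)"
        using \<delta>(3) by (metis mult.assoc)
      also have "\<dots> \<le> \<epsilon> * real (card (A x \<inter> A y))" using I \<epsilon> by (intro mult_left_mono) auto
      finally show "real (card (sym_diff (A x) (A y))) / real (card (A x \<inter> A y)) \<le> \<epsilon>"
        using cD I pos by (simp add: divide_le_eq)
    qed simp
  qed
  moreover have "discrete_metric_space (submetric X D)"
    using sep unfolding discrete_metric_space_def by (auto intro!: exI[of _ 1])
  ultimately show ?thesis
    unfolding discrete_property_A_def sp mdist_submetric by blast
qed

theorem theorem3p5:
  fixes X :: "'a metric"
  assumes "sFDC X"
  shows "property_A X"
proof -
  obtain D where D: "D \<subseteq> mspace X" "\<And>x y. x \<in> D \<Longrightarrow> y \<in> D \<Longrightarrow> x \<noteq> y \<Longrightarrow> mdist X x y \<ge> 1"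
    "\<And>x. x \<in> mspace X \<Longrightarrow> \<exists>y\<in>D. mdist X x y \<le> 1"
    using maximal_separated_subset[of X] by metis
  then have "coarsely_dense X D"
    unfolding coarsely_dense_def by (auto intro!: exI[of _ 1])
  then show ?thesis
    unfolding property_A_def
    using separated_net_discrete_property_A[OF sFDC_randomly_retractable[OF assms] D] by blast
qed

end
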